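(* For $\pi_0,\widehat\pi_0\in\mathcal P(\mathcal X)$ let $E_t:=\|\Phi_{Y_{1:t}}(\pi_0)-\Phi_{Y_{1:t}}(\widehat\pi_0)\|_{\mathrm{TV}}$, $t\ge1$. Then $\{\Phi_{Y_t}\}_{t\ge1}$ is stable if and only if $E_t\to0$ in probability (for every pair $\pi_0,\widehat\pi_0$). Moreover, under either of these equivalent conditions, $\operatorname{Var}(E_t)\to0$.
   Context: Let $(\Omega,\mathcal F,\mathbb P)$ be a probability space, $\mathcal X\subseteq\mathbb R^{d_x}$ and $\mathcal Y\subseteq\mathbb R^{d_y}$ Borel sets, $\mathcal P(\mathcal X)$ the set of Borel probability measures on $\mathcal X$. A state-space model $(\pi_0,K,g)$ consists of $\pi_0\in\mathcal P(\mathcal X)$, Markov kernels $K=\{K_t\}_{t\ge1}$ on $\mathcal X$, and measurable functions $g_t:\mathcal Y\times\mathcal X\to(0,\infty)$ with $\int_{\mathcal Y}g_t(y\mid x)\,dy=1$ for all $x$. States: $X_0\sim\pi_0$, $X_t\mid X_{t-1}=x\sim K_t(x,\cdot)$; the observations $Y_t$ are conditionally independent given the states, with $Y_t\mid X_t=x$ having Lebesgue density $g_t(\cdot\mid x)$. The observations (and hence $\mathbb E$, variance and convergence in probability) are those generated by the model with prior $\pi_0$. Write $g_{y_t}(x):=g_t(y_t\mid x)$, $\mu(f):=\int f\,d\mu$, $K_t(\mu)(A):=\int K_t(x,A)\,\mu(dx)$, $U_{y_t}(\mu)(dx):=g_{y_t}(x)\,\mu(dx)/\mu(g_{y_t})$,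 $\Phi_{Y_t}:=U_{Y_t}\circ K_t$, and $\Phi_{Y_{1:t}}:=\Phi_{Y_t}\circ\cdots\circ\Phi_{Y_1}$. For a finite signed measure $m$, $\|m\|_{\mathrm{TV}}:=\tfrac12\big(\sup_F m(F)-\inf_F m(F)\big)$, over Borel sets $F$. Stability (in expectation): $\{\Phi_{Y_t}\}_{t\ge1}$ is stable if for every pair of priors $\pi_0,\widehat\pi_0\in\mathcal P(\mathcal X)$, $\lim_{t\to\infty}\mathbb E[\|\Phi_{Y_{1:t}}(\pi_0)-\Phi_{Y_{1:t}}(\widehat\pi_0)\|_{\mathrm{TV}}]=0$. *)

theory Defs
  imports "HOL-Probability.Probability"
begin

abbreviation borel_on :: "'a::euclidean_space set \<Rightarrow> 'a measure" where
  "borel_on S \<equiv> restrict_space borel S"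

abbreviation borel_probs :: "'a::euclidean_space set \<Rightarrow> 'a measure set" where
  "borel_probs S \<equiv> space (prob_algebra (borel_on S))"

(* K t and g t are used for t >= 1 only; g t y x stands for g_t(y | x). *)
locale state_space_model =
  fixes S :: "'x::euclidean_space set" and Obs :: "'y::euclidean_space set"
    and K :: "nat \<Rightarrow> 'x \<Rightarrow> 'x measure" and g :: "nat \<Rightarrow> 'y \<Rightarrow> 'x \<Rightarrow> real"
  assumes borel_S: "S \<in> sets borel"
    and borel_Obs: "Obs \<in> sets borel"
    and kernel: "\<And>t. t \<ge> 1 \<Longrightarrow> K t \<in> borel_on S \<rightarrow>\<^sub>M prob_algebra (borel_on S)"
    and g_measurable:
      "\<And>t. t \<ge> 1 \<Longrightarrow> (\<lambda>(y, x). g t y x) \<in> borel_measurable (borel_on Obs \<Otimes>\<^sub>M borel_on S)"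
    and g_pos: "\<And>t y x. t \<ge> 1 \<Longrightarrow> y \<in> Obs \<Longrightarrow> x \<in> S \<Longrightarrow> g t y x > 0"
    and g_normalized:
      "\<And>t x. t \<ge> 1 \<Longrightarrow> x \<in> S \<Longrightarrow> (\<integral>\<^sup>+y\<in>Obs. ennreal (g t y x) \<partial>lborel) = 1"

text \<open>The sigma-algebra on \<open>space M\<close> generated by the \<open>S\<close>-valued variables \<open>X t\<close>, \<open>t \<in> I\<close>.\<close>

definition generated ::
  "'w measure \<Rightarrow> 'x::euclidean_space set \<Rightarrow> nat set \<Rightarrow> (nat \<Rightarrow> 'w \<Rightarrow> 'x) \<Rightarrow> 'w measure" where
  "generated M S I X =
     vimage_algebra (space M) (\<lambda>\<omega>. \<lambda>t\<in>I. X t \<omega>) (\<Pi>\<^sub>M t\<in>I. borel_on S)"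

text \<open>
  \<open>X\<close> and \<open>Y\<close> are the states and observations, on the probability space \<open>M\<close>, of the model with
  prior \<open>\<pi>\<^sub>0\<close>. Conditioning \<open>Y t\<close> on all the states, and not on \<open>X t\<close> alone, is what makes
  its law depend on the states through \<open>X t\<close> only.
\<close>

locale model_process = state_space_model S Obs K g + prob_space M
  for S :: "'x::euclidean_space set" and Obs :: "'y::euclidean_space set"
    and K :: "nat \<Rightarrow> 'x \<Rightarrow> 'x measure" and g :: "nat \<Rightarrow> 'y \<Rightarrow> 'x \<Rightarrow> real"
    and M :: "'w measure" +
  fixes \<pi>\<^sub>0 :: "'x measure" and X :: "nat \<Rightarrow> 'w \<Rightarrow> 'x" and Y :: "nat \<Rightarrow> 'w \<Rightarrow> 'y"
  assumes X_measurable: "\<And>t. X t \<in> M \<rightarrow>\<^sub>M borel_on S"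
    and Y_measurable: "\<And>t. t \<ge> 1 \<Longrightarrow> Y t \<in> M \<rightarrow>\<^sub>M borel_on Obs"
    and initial: "distr M (borel_on S) (X 0) = \<pi>\<^sub>0"
    and transition:
      "\<And>t A. t \<ge> 1 \<Longrightarrow> A \<in> sets (borel_on S) \<Longrightarrow>
         AE \<omega> in M. real_cond_exp M (generated M S {..<t} X) (\<lambda>\<omega>'. indicator A (X t \<omega>')) \<omega>
           = measure (K t (X (t - 1) \<omega>)) A"
    and observation_density:
      "\<And>t B. t \<ge> 1 \<Longrightarrow> B \<in> sets (borel_on Obs) \<Longrightarrow>
         AE \<omega> in M. real_cond_exp M (generated M S UNIV X) (\<lambda>\<omega>'. indicator B (Y t \<omega>')) \<omega>
           = (LINT y:B|lborel. g t y (X t \<omega>))"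
    and observations_cond_indep:
      "\<And>J B. finite J \<Longrightarrow> J \<subseteq> {1..} \<Longrightarrow> (\<And>t. t \<in> J \<Longrightarrow> B t \<in> sets (borel_on Obs)) \<Longrightarrow>
         AE \<omega> in M.
           real_cond_exp M (generated M S UNIV X) (\<lambda>\<omega>'. \<Prod>t\<in>J. indicator (B t) (Y t \<omega>')) \<omega>
           = (\<Prod>t\<in>J. real_cond_exp M (generated M S UNIV X) (\<lambda>\<omega>'. indicator (B t) (Y t \<omega>')) \<omega>)"

text \<open>
  The Bayes update \<open>U\<^sub>y\<close>, with \<open>h = g t y\<close>. The normalizer \<open>\<mu>(h)\<close> is positive for a
  probability measure \<open>\<mu>\<close>, but it can be infinite for exceptional observations \<open>y\<close>
  (a null event under the model); the update is then the null measure.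
\<close>

definition bayes_update :: "('x \<Rightarrow> real) \<Rightarrow> 'x measure \<Rightarrow> 'x measure" where
  "bayes_update h \<mu> = density \<mu> (\<lambda>x. ennreal (h x) / (\<integral>\<^sup>+x'. ennreal (h x') \<partial>\<mu>))"

definition filter_step ::
  "(nat \<Rightarrow> 'x \<Rightarrow> 'x measure) \<Rightarrow> (nat \<Rightarrow> 'y \<Rightarrow> 'x \<Rightarrow> real) \<Rightarrow> nat \<Rightarrow> 'y \<Rightarrow> 'x measure \<Rightarrow> 'x measure" where
  "filter_step K g t y \<mu> = bayes_update (g t y) (\<mu> \<bind> K t)"

primrec filter_upto ::
  "(nat \<Rightarrow> 'x \<Rightarrow> 'x measure) \<Rightarrow> (nat \<Rightarrow> 'y \<Rightarrow> 'x \<Rightarrow> real) \<Rightarrow> (nat \<Rightarrow> 'y) \<Rightarrow> nat \<Rightarrow> 'x measure \<Rightarrow> 'x measure"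
where
  "filter_upto K g y 0 \<mu> = \<mu>"
| "filter_upto K g y (Suc t) \<mu> = filter_step K g (Suc t) (y (Suc t)) (filter_upto K g y t \<mu>)"

text \<open>A finite signed measure is given by its values \<open>m\<close> on a sigma-algebra \<open>\<F>\<close>.\<close>

definition tv_norm :: "'a set set \<Rightarrow> ('a set \<Rightarrow> real) \<Rightarrow> real" where
  "tv_norm \<F> m = 1/2 * ((SUP F\<in>\<F>. m F) - (INF F\<in>\<F>. m F))"

definition filter_error ::
  "'x::euclidean_space set \<Rightarrow> (nat \<Rightarrow> 'x \<Rightarrow> 'x measure) \<Rightarrow> (nat \<Rightarrow> 'y \<Rightarrow> 'x \<Rightarrow> real) \<Rightarrow>
   (nat \<Rightarrow> 'w \<Rightarrow> 'y) \<Rightarrow> 'x measure \<Rightarrow> 'x measure \<Rightarrow> nat \<Rightarrow> 'w \<Rightarrow> real" where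
  "filter_error S K g Y \<mu> \<nu> t \<omega> =
     tv_norm (sets (borel_on S))
       (\<lambda>F. measure (filter_upto K g (\<lambda>s. Y s \<omega>) t \<mu>) F
          - measure (filter_upto K g (\<lambda>s. Y s \<omega>) t \<nu>) F)"

text \<open>
  For each prior \<open>\<mu>\<close>, \<open>Y \<mu>\<close> is the observation process of the model with prior \<open>\<mu>\<close>, and
  \<open>P \<mu>\<close> the probability space carrying it.
\<close>

definition filter_stable ::
  "'x::euclidean_space set \<Rightarrow> (nat \<Rightarrow> 'x \<Rightarrow> 'x measure) \<Rightarrow> (nat \<Rightarrow> 'y \<Rightarrow> 'x \<Rightarrow> real) \<Rightarrow>
   ('x measure \<Rightarrow> 'w measure) \<Rightarrow> ('x measure \<Rightarrow> nat \<Rightarrow> 'w \<Rightarrow> 'y) \<Rightarrow> bool" where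
  "filter_stable S K g P Y \<longleftrightarrow>
     (\<forall>\<mu>\<in>borel_probs S. \<forall>\<nu>\<in>borel_probs S.
        (\<lambda>t. prob_space.expectation (P \<mu>) (filter_error S K g (Y \<mu>) \<mu> \<nu> t)) \<longlonglongrightarrow> 0)"

definition converges_in_prob :: "'w measure \<Rightarrow> (nat \<Rightarrow> 'w \<Rightarrow> real) \<Rightarrow> real \<Rightarrow> bool" where
  "converges_in_prob M Z c \<longleftrightarrow>
     (\<forall>\<epsilon>>0. (\<lambda>t. \<P>(\<omega> in M. \<bar>Z t \<omega> - c\<bar> > \<epsilon>)) \<longlonglongrightarrow> 0)"

end

theory Submission
  imports Defs
begin

text \<open>
  The filtering error takes values in \<open>[0, 1]\<close>, since the filters are subprobability
  measures. For random variables with values in \<open>[0, 1]\<close>, convergence to \<open>0\<close> in mean and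
  in probability are equivalent: \<open>\<epsilon> P(Z > \<epsilon>) \<le> E Z \<le> \<epsilon> + P(Z > \<epsilon>)\<close>
  (\<open>mean_tendsto_0_iff_converges_in_prob\<close>); and \<open>Var Z \<le> E (Z\<^sup>2) \<le> E Z\<close>, so both make the
  variance vanish (\<open>variance_tendsto_0\<close>).

  What takes work is that the error is a random variable at all, because the total variation norm
  is a supremum over uncountably many sets. The filters depend measurably on the observations
  (\<open>filter_upto_measurable\<close>), so the mass of each single set is a random variable. By outer
  regularity, every Borel set can be approximated, in two finite measures at once, by a finite
  union of basic open sets (\<open>finite_union_basis_approx\<close>). There are only countably many such
  unions, so the supremum reduces to a countable one (\<open>tv_norm_eq_dense\<close>).
\<close>

section \<open>Random variables with values in the unit interval\<close>

context prob_space
begin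

lemma integrable_unit_interval:
  fixes Z :: "'a \<Rightarrow> real"
  assumes "Z \<in> borel_measurable M" and "\<And>\<omega>. \<omega> \<in> space M \<Longrightarrow> Z \<omega> \<in> {0..1}"
  shows "integrable M Z"
  using assms by (intro integrable_const_bound[where B = 1] AE_I2) auto

lemma Markov_unit_interval:
  fixes Z :: "'a \<Rightarrow> real"
  assumes Z: "Z \<in> borel_measurable M" "\<And>\<omega>. \<omega> \<in> space M \<Longrightarrow> Z \<omega> \<in> {0..1}" and "\<epsilon> > 0"
  shows "\<P>(\<omega> in M. \<bar>Z \<omega>\<bar> > \<epsilon>) \<le> expectation Z / \<epsilon>"
proof -
  note [measurable] = Z(1)
  have "\<P>(\<omega> in M. \<bar>Z \<omega>\<bar> > \<epsilon>) \<le> \<P>(\<omega> in M. Z \<omega> \<ge> \<epsilon>)"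
    using Z(2) by (intro finite_measure_mono) force+
  also have "\<dots> \<le> expectation Z / \<epsilon>"
    using Z \<open>\<epsilon> > 0\<close> by (intro integral_Markov_inequality_measure[where A = "space M"]
      integrable_unit_interval AE_I2) auto
  finally show ?thesis .
qed

lemma expectation_le_epsilon_plus_prob:
  fixes Z :: "'a \<Rightarrow> real"
  assumes Z: "Z \<in> borel_measurable M" "\<And>\<omega>. \<omega> \<in> space M \<Longrightarrow> Z \<omega> \<in> {0..1}" and "\<epsilon> > 0"
  shows "expectation Z \<le> \<epsilon> + \<P>(\<omega> in M. \<bar>Z \<omega>\<bar> > \<epsilon>)"
proof -
  note [measurable] = Z(1)
  let ?A = "{\<omega> \<in> space M. \<bar>Z \<omega>\<bar> > \<epsilon>}"
  have A: "?A \<in> sets M" by measurable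
  have "expectation Z \<le> expectation (\<lambda>\<omega>. \<epsilon> + indicator ?A \<omega>)"
  proof (rule integral_mono)
    show "integrable M Z" by (rule integrable_unit_interval[OF Z])
    show "integrable M (\<lambda>\<omega>. \<epsilon> + indicator ?A \<omega>)"
      using A by (intro Bochner_Integration.integrable_add integrable_real_indicator)
        (auto simp: emeasure_eq_measure)
    fix \<omega> assume "\<omega> \<in> space M"
    then show "Z \<omega> \<le> \<epsilon> + indicator ?A \<omega>"
      using Z(2)[of \<omega>] \<open>\<epsilon> > 0\<close> by (auto simp: indicator_def)
  qed
  also have "\<dots> = \<epsilon> + measure M ?A"
    using A by (subst Bochner_Integration.integral_add) (auto simp: emeasure_eq_measure prob_space)
  finally show ?thesis .
qed

lemma mean_tendsto_0_iff_converges_in_prob: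
  fixes Z :: "nat \<Rightarrow> 'a \<Rightarrow> real"
  assumes Z: "\<And>t. Z t \<in> borel_measurable M"
    "\<And>t \<omega>. \<omega> \<in> space M \<Longrightarrow> Z t \<omega> \<in> {0..1}"
  shows "(\<lambda>t. expectation (Z t)) \<longlonglongrightarrow> 0 \<longleftrightarrow> converges_in_prob M Z 0"
proof
  assume *: "(\<lambda>t. expectation (Z t)) \<longlonglongrightarrow> 0"
  show "converges_in_prob M Z 0"
    unfolding converges_in_prob_def
  proof (intro allI impI)
    fix \<epsilon> :: real assume "\<epsilon> > 0"
    show "(\<lambda>t. \<P>(\<omega> in M. \<bar>Z t \<omega> - 0\<bar> > \<epsilon>)) \<longlonglongrightarrow> 0"
    proof (rule tendsto_sandwich[OF _ _ tendsto_const])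
      show "(\<lambda>t. expectation (Z t) / \<epsilon>) \<longlonglongrightarrow> 0"
        using tendsto_divide[OF * tendsto_const, of \<epsilon>] \<open>\<epsilon> > 0\<close> by simp
      show "\<forall>\<^sub>F t in sequentially. \<P>(\<omega> in M. \<bar>Z t \<omega> - 0\<bar> > \<epsilon>) \<le> expectation (Z t) / \<epsilon>"
        using Markov_unit_interval[OF Z \<open>\<epsilon> > 0\<close>] by simp
    qed simp
  qed
next
  assume *: "converges_in_prob M Z 0"
  show "(\<lambda>t. expectation (Z t)) \<longlonglongrightarrow> 0"
  proof (rule LIMSEQ_I)
    fix r :: real assume "r > 0"
    then have r: "r / 2 > 0" by simp
    have "(\<lambda>t. \<P>(\<omega> in M. \<bar>Z t \<omega>\<bar> > r / 2)) \<longlonglongrightarrow> 0"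
      using *[unfolded converges_in_prob_def diff_0_right, rule_format, OF r] .
    from LIMSEQ_D[OF this r] obtain N
      where N: "\<And>t. t \<ge> N \<Longrightarrow> \<P>(\<omega> in M. \<bar>Z t \<omega>\<bar> > r / 2) < r / 2" by auto
    have "norm (expectation (Z t) - 0) < r" if "t \<ge> N" for t
    proof -
      have "expectation (Z t) \<ge> 0" using Z(2) by (intro Bochner_Integration.integral_nonneg) auto
      then show ?thesis
        using N[OF that] expectation_le_epsilon_plus_prob[OF Z r, of t] by simp
    qed
    then show "\<exists>N. \<forall>t\<ge>N. norm (expectation (Z t) - 0) < r" by blast
  qed
qed

lemma variance_tendsto_0:
  fixes Z :: "nat \<Rightarrow> 'a \<Rightarrow> real"
  assumes Z: "\<And>t. Z t \<in> borel_measurable M"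
    "\<And>t \<omega>. \<omega> \<in> space M \<Longrightarrow> Z t \<omega> \<in> {0..1}"
    and lim: "(\<lambda>t. expectation (Z t)) \<longlonglongrightarrow> 0"
  shows "(\<lambda>t. variance (Z t)) \<longlonglongrightarrow> 0"
proof (rule tendsto_sandwich[OF _ _ tendsto_const lim])
  show "\<forall>\<^sub>F t in sequentially. variance (Z t) \<le> expectation (Z t)"
  proof (intro always_eventually allI)
    fix t
    have le: "(Z t \<omega>)\<^sup>2 \<in> {0..1}" "(Z t \<omega>)\<^sup>2 \<le> Z t \<omega>" if "\<omega> \<in> space M" for \<omega>
      using Z(2)[OF that, of t] by (auto simp: power2_eq_square mult_le_one mult_left_le)
    have int: "integrable M (Z t)" "integrable M (\<lambda>\<omega>. (Z t \<omega>)\<^sup>2)"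
      using Z le by (auto intro!: integrable_unit_interval)
    have "variance (Z t) = expectation (\<lambda>\<omega>. (Z t \<omega>)\<^sup>2) - (expectation (Z t))\<^sup>2"
      using int by (rule variance_eq)
    also have "\<dots> \<le> expectation (\<lambda>\<omega>. (Z t \<omega>)\<^sup>2)" by simp
    also have "\<dots> \<le> expectation (Z t)" using int le by (intro integral_mono) auto
    finally show "variance (Z t) \<le> expectation (Z t)" .
  qed
qed (simp add: variance_positive)

end

section \<open>The total variation norm as a countable supremum\<close>

lemma SUP_eq_dense:
  fixes m :: "'a \<Rightarrow> real"
  assumes "\<C> \<subseteq> \<A>" "\<C> \<noteq> {}" and bdd: "\<And>F. F \<in> \<A> \<Longrightarrow> \<bar>m F\<bar> \<le> b"
    and dense: "\<And>F e. F \<in> \<A> \<Longrightarrow> e > 0 \<Longrightarrow> \<exists>G\<in>\<C>. \<bar>m F - m G\<bar> < e"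
  shows "(SUP F\<in>\<A>. m F) = (SUP F\<in>\<C>. m F)"
proof (rule antisym)
  have bddA: "bdd_above (m ` \<A>)" by (rule bdd_aboveI2[of _ _ b]) (use bdd in force)
  then have bddC: "bdd_above (m ` \<C>)" using \<open>\<C> \<subseteq> \<A>\<close> by (meson bdd_above_mono image_mono)
  show "(SUP F\<in>\<C>. m F) \<le> (SUP F\<in>\<A>. m F)" using assms(1,2) bddA by (intro cSUP_subset_mono) auto
  show "(SUP F\<in>\<A>. m F) \<le> (SUP F\<in>\<C>. m F)"
  proof (rule cSUP_least)
    show "\<A> \<noteq> {}" using assms by auto
    fix F assume F: "F \<in> \<A>"
    show "m F \<le> (SUP F\<in>\<C>. m F)"
    proof (rule field_le_epsilon)
      fix e :: real assume "e > 0"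
      then obtain G where G: "G \<in> \<C>" "\<bar>m F - m G\<bar> < e" using dense[OF F] by blast
      then show "m F \<le> (SUP F\<in>\<C>. m F) + e" using cSUP_upper[OF G(1) bddC] by simp
    qed
  qed
qed

lemma INF_eq_minus_SUP: "(INF F\<in>\<A>. m F) = - (SUP F\<in>\<A>. - m F)" for m :: "'a \<Rightarrow> real"
  by (simp add: Inf_real_def image_image)

lemma tv_norm_eq_dense:
  assumes "\<C> \<subseteq> \<A>" "\<C> \<noteq> {}" and "\<And>F. F \<in> \<A> \<Longrightarrow> \<bar>m F\<bar> \<le> b"
    and "\<And>F e. F \<in> \<A> \<Longrightarrow> e > 0 \<Longrightarrow> \<exists>G\<in>\<C>. \<bar>m F - m G\<bar> < e"
  shows "tv_norm \<A> m = tv_norm \<C> m"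
proof -
  have "\<exists>G\<in>\<C>. \<bar>- m F - - m G\<bar> < e" if "F \<in> \<A>" "e > 0" for F e
    using assms(4)[OF that] by (simp add: abs_minus_commute)
  then show ?thesis
    unfolding tv_norm_def INF_eq_minus_SUP
    using SUP_eq_dense[of \<C> \<A> m b] SUP_eq_dense[of \<C> \<A> "\<lambda>F. - m F" b] assms by simp
qed

lemma tv_norm_unit_interval:
  assumes ne: "\<A> \<noteq> {}" and bdd: "\<And>F. F \<in> \<A> \<Longrightarrow> \<bar>m F\<bar> \<le> 1"
  shows "tv_norm \<A> m \<in> {0..1}"
proof -
  have le: "m F \<le> 1" "m F \<ge> -1" if "F \<in> \<A>" for F using bdd[OF that] by auto
  have "(SUP F\<in>\<A>. m F) \<le> 1" "(INF F\<in>\<A>. m F) \<ge> -1"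
    using ne le by (auto intro!: cSUP_least cINF_greatest)
  moreover have "(INF F\<in>\<A>. m F) \<le> (SUP F\<in>\<A>. m F)"
  proof -
    obtain F where F: "F \<in> \<A>" using ne by blast
    have "(INF F\<in>\<A>. m F) \<le> m F" using F le by (intro cINF_lower bdd_belowI2[of _ "-1"]) auto
    also have "\<dots> \<le> (SUP F\<in>\<A>. m F)" using F le by (intro cSUP_upper bdd_aboveI2[of _ _ 1]) auto
    finally show ?thesis .
  qed
  ultimately show ?thesis by (simp add: tv_norm_def)
qed

lemma tv_norm_measurable:
  assumes C: "countable \<C>" "\<C> \<noteq> {}"
    and meas: "\<And>F. F \<in> \<C> \<Longrightarrow> (\<lambda>\<omega>. m \<omega> F) \<in> borel_measurable M"
    and bdd: "\<And>F \<omega>. \<omega> \<in> space M \<Longrightarrow> F \<in> \<C> \<Longrightarrow> \<bar>m \<omega> F\<bar> \<le> b"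
  shows "(\<lambda>\<omega>. tv_norm \<C> (m \<omega>)) \<in> borel_measurable M"
proof -
  have *: "m \<omega> F \<le> b" "- b \<le> m \<omega> F" if "\<omega> \<in> space M" "F \<in> \<C>" for F \<omega> using bdd[OF that] by auto
  have [measurable]: "(\<lambda>\<omega>. SUP F\<in>\<C>. m \<omega> F) \<in> borel_measurable M"
    by (rule borel_measurable_cSUP[OF C(1) meas]) (auto intro!: bdd_aboveI2[of _ _ b] *)
  have [measurable]: "(\<lambda>\<omega>. INF F\<in>\<C>. m \<omega> F) \<in> borel_measurable M"
    by (rule borel_measurable_cINF[OF C(1) meas]) (auto intro!: bdd_belowI2[of _ "-b"] *)
  show ?thesis unfolding tv_norm_def by measurable
qed

text \<open>
  Outer regularity gives an open superset of \<open>F\<close> of nearly the same mass for each of the two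
  measures; their intersection serves both. It is an increasing union of finite unions of
  basic sets, and continuity from below yields one that serves both.
\<close>

lemma finite_union_basis_approx:
  fixes \<mu> \<nu> :: "'a::{second_countable_topology, complete_space} measure"
  assumes fin: "finite_measure \<mu>" "finite_measure \<nu>"
    and sets: "sets \<mu> = sets borel" "sets \<nu> = sets borel"
    and B: "topological_basis B" "countable B"
    and F: "F \<in> sets borel" and "e > 0"
  shows "\<exists>D. finite D \<and> D \<subseteq> B \<and> \<bar>measure \<mu> F - measure \<mu> (\<Union>D)\<bar> < e
           \<and> \<bar>measure \<nu> F - measure \<nu> (\<Union>D)\<bar> < e"
proof -
  have outer: "\<exists>U. open U \<and> F \<subseteq> U \<and> measure \<rho> U < measure \<rho> F + e"
    if "finite_measure \<rho>" "sets \<rho> = sets borel" for \<rho> :: "'a measure"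
  proof -
    interpret finite_measure \<rho> by fact
    have "emeasure \<rho> F = (INF U\<in>{U. F \<subseteq> U \<and> open U}. emeasure \<rho> U)"
      using that F by (intro outer_regular) (auto simp: emeasure_eq_measure)
    moreover have "emeasure \<rho> F < ennreal (measure \<rho> F + e)"
      using \<open>e > 0\<close> by (simp add: emeasure_eq_measure ennreal_less_iff)
    ultimately obtain U where "F \<subseteq> U" "open U" "emeasure \<rho> U < ennreal (measure \<rho> F + e)"
      by (auto simp: INF_less_iff)
    then have "measure \<rho> U < measure \<rho> F + e"
      using \<open>e > 0\<close> by (simp add: emeasure_eq_measure ennreal_less_iff del: ennreal_plus)
    with \<open>F \<subseteq> U\<close> \<open>open U\<close> show ?thesis by blast
  qed
  obtain U1 where U1: "open U1" "F \<subseteq> U1" "measure \<mu> U1 < measure \<mu> F + e"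
    using outer[OF fin(1) sets(1)] by blast
  obtain U2 where U2: "open U2" "F \<subseteq> U2" "measure \<nu> U2 < measure \<nu> F + e"
    using outer[OF fin(2) sets(2)] by blast
  define U where "U = U1 \<inter> U2"
  have U: "open U" "F \<subseteq> U" using U1 U2 by (auto simp: U_def)
  have "measure \<mu> U \<le> measure \<mu> U1" "measure \<nu> U \<le> measure \<nu> U2"
    using U1 U2 sets fin by (auto simp: U_def intro!: finite_measure.finite_measure_mono)
  then have close: "measure \<mu> U < measure \<mu> F + e" "measure \<nu> U < measure \<nu> F + e"
    using U1 U2 by auto
  have ge: "measure \<mu> F \<le> measure \<mu> U" "measure \<nu> F \<le> measure \<nu> U"
    using U sets fin by (auto intro!: finite_measure.finite_measure_mono)
  obtain B' where B': "B' \<subseteq> B" "\<Union>B' = U" using B(1) U(1) by (auto simp: topological_basis_def)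
  show ?thesis
  proof (cases "B' = {}")
    case True
    with B' U have "F = {}" by auto
    then show ?thesis using \<open>e > 0\<close> by (intro exI[of _ "{}"]) auto
  next
    case False
    have "countable B'" using B' B countable_subset by blast
    then have rng: "range (from_nat_into B') = B'" using False by simp
    define V where "V n = \<Union>(from_nat_into B' ` {..n})" for n
    have inc: "incseq V" unfolding V_def by (intro monoI Union_mono image_mono) simp
    have UV: "(\<Union>n. V n) = U"
    proof -
      have "(\<Union>n. V n) = \<Union>(range (from_nat_into B'))" unfolding V_def by blast
      then show ?thesis using B'(2) rng by simp
    qed
    have open': "open W" if "W \<in> B'" for W using that B' B(1) topological_basis_open by blast
    have "open (V n)" for n unfolding V_def using rng open' by (intro open_Union) blast
    then have Vb: "V n \<in> sets borel" for n by simp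
    have lim: "(\<lambda>n. measure \<rho> (V n)) \<longlonglongrightarrow> measure \<rho> U"
      if "finite_measure \<rho>" "sets \<rho> = sets borel" for \<rho>
      using finite_measure.finite_Lim_measure_incseq[OF that(1) _ inc] Vb that(2) UV by auto
    have "\<forall>\<^sub>F n in sequentially. \<bar>measure \<rho> F - measure \<rho> (V n)\<bar> < e"
      if \<rho>: "finite_measure \<rho>" "sets \<rho> = sets borel"
        and c: "measure \<rho> U < measure \<rho> F + e" "measure \<rho> F \<le> measure \<rho> U" for \<rho>
    proof -
      have le: "measure \<rho> (V n) \<le> measure \<rho> U" for n
        using \<rho> U(1) UV by (intro finite_measure.finite_measure_mono) auto
      have "\<forall>\<^sub>F n in sequentially. measure \<rho> (V n) > measure \<rho> F - e"
        using order_tendstoD(1)[OF lim[OF \<rho>]] c \<open>e > 0\<close> by simp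
      then show ?thesis
      proof (rule eventually_mono)
        fix n assume "measure \<rho> (V n) > measure \<rho> F - e"
        then show "\<bar>measure \<rho> F - measure \<rho> (V n)\<bar> < e" using c le[of n] by linarith
      qed
    qed
    note eventually_happens'[OF sequentially_bot
      eventually_conj[OF this[OF fin(1) sets(1) close(1) ge(1)] this[OF fin(2) sets(2) close(2) ge(2)]]]
    then obtain n where "\<bar>measure \<mu> F - measure \<mu> (V n)\<bar> < e" "\<bar>measure \<nu> F - measure \<nu> (V n)\<bar> < e"
      by blast
    moreover have "from_nat_into B' ` {..n} \<subseteq> B" using rng B' by blast
    ultimately show ?thesis unfolding V_def by blast
  qed
qed

text \<open>
  The trace on \<open>S\<close>: outer regularity concerns measures on the whole space, so measures on \<open>S\<close>
  are pushed forward along the inclusion.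
\<close>

lemma finite_union_basis_approx_on:
  fixes \<mu> \<nu> :: "'a::euclidean_space measure"
  assumes S: "S \<in> sets borel"
    and fin: "finite_measure \<mu>" "finite_measure \<nu>"
    and sets: "sets \<mu> = sets (borel_on S)" "sets \<nu> = sets (borel_on S)"
    and B: "topological_basis B" "countable B"
    and F: "F \<in> sets (borel_on S)" and "e > 0"
  shows "\<exists>D. finite D \<and> D \<subseteq> B \<and> \<bar>measure \<mu> F - measure \<mu> (\<Union>D \<inter> S)\<bar> < e
           \<and> \<bar>measure \<nu> F - measure \<nu> (\<Union>D \<inter> S)\<bar> < e"
proof -
  have id: "(\<lambda>x. x) \<in> \<rho> \<rightarrow>\<^sub>M borel" if "sets \<rho> = sets (borel_on S)" for \<rho>
    unfolding measurable_cong_sets[OF that refl] by (rule measurable_restrict_space1) simp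
  have spc: "space \<rho> = S" if "sets \<rho> = sets (borel_on S)" for \<rho>
    using sets_eq_imp_space_eq[OF that] by (simp add: space_restrict_space)
  have Fb: "F \<in> sets borel" "F \<subseteq> S" using F S by (auto simp: sets_restrict_space_iff)
  obtain D where D: "finite D" "D \<subseteq> B"
    "\<bar>measure (distr \<mu> borel (\<lambda>x. x)) F - measure (distr \<mu> borel (\<lambda>x. x)) (\<Union>D)\<bar> < e"
    "\<bar>measure (distr \<nu> borel (\<lambda>x. x)) F - measure (distr \<nu> borel (\<lambda>x. x)) (\<Union>D)\<bar> < e"
    using finite_union_basis_approx[OF finite_measure.finite_measure_distr[OF fin(1) id[OF sets(1)]]
       finite_measure.finite_measure_distr[OF fin(2) id[OF sets(2)]] _ _ B Fb(1) \<open>e > 0\<close>] by auto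
  have "open W" if "W \<in> D" for W using that D B(1) topological_basis_open by blast
  then have Db: "\<Union>D \<in> sets borel" by (intro borel_open open_Union) blast
  have "measure (distr \<rho> borel (\<lambda>x. x)) A = measure \<rho> (A \<inter> S)"
    if "A \<in> sets borel" "sets \<rho> = sets (borel_on S)" for A \<rho>
    using measure_distr[OF id[OF that(2)] that(1)] spc[OF that(2)] by simp
  moreover have "F \<inter> S = F" using Fb by blast
  ultimately show ?thesis using D Fb(1) Db sets by (intro exI[of _ D]) simp
qed

lemma subprob_measure_diff_le_1:
  assumes "subprob_space \<mu>" "subprob_space \<nu>"
  shows "\<bar>measure \<mu> F - measure \<nu> F\<bar> \<le> 1"
  using subprob_space.subprob_measure_le_1[OF assms(1), of F]
    subprob_space.subprob_measure_le_1[OF assms(2), of F]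
    measure_nonneg[of \<mu> F] measure_nonneg[of \<nu> F] by linarith

lemma tv_norm_subprob_measurable:
  fixes S :: "'x::euclidean_space set"
  assumes S: "S \<in> sets borel"
    and \<mu>: "\<mu> \<in> M \<rightarrow>\<^sub>M subprob_algebra (borel_on S)"
    and \<nu>: "\<nu> \<in> M \<rightarrow>\<^sub>M subprob_algebra (borel_on S)"
  shows "(\<lambda>\<omega>. tv_norm (sets (borel_on S)) (\<lambda>F. measure (\<mu> \<omega>) F - measure (\<nu> \<omega>) F))
           \<in> borel_measurable M"
proof -
  obtain B :: "'x set set" where B: "countable B" "topological_basis B"
    using ex_countable_basis by blast
  define \<C> where "\<C> = (\<lambda>D. \<Union>D \<inter> S) ` {D. D \<subseteq> B \<and> finite D}"
  have C: "countable \<C>" "\<C> \<noteq> {}"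
    using countable_Collect_finite_subset[OF B(1)] by (auto simp: \<C>_def conj_commute)
  have "\<Union>D \<in> sets borel" if "D \<subseteq> B" for D
    using that topological_basis_open[OF B(2)] by (intro borel_open open_Union) blast
  then have CS: "\<C> \<subseteq> sets (borel_on S)" using S by (auto simp: \<C>_def sets_restrict_space_iff)
  have sub: "subprob_space (\<rho> \<omega>)" "sets (\<rho> \<omega>) = sets (borel_on S)"
    if "\<omega> \<in> space M" "\<rho> \<in> M \<rightarrow>\<^sub>M subprob_algebra (borel_on S)" for \<omega> \<rho>
    using measurable_space[OF that(2,1)] by (auto simp: space_subprob_algebra)
  note bdd = subprob_measure_diff_le_1[OF sub(1)[OF _ \<mu>] sub(1)[OF _ \<nu>]]
  have meas: "(\<lambda>\<omega>. measure (\<mu> \<omega>) F - measure (\<nu> \<omega>) F) \<in> borel_measurable M" if "F \<in> \<C>" for F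
    using that CS by (intro borel_measurable_diff
      measurable_compose[OF \<mu> measurable_measure_subprob_algebra]
      measurable_compose[OF \<nu> measurable_measure_subprob_algebra]) auto
  have "(\<lambda>\<omega>. tv_norm \<C> (\<lambda>F. measure (\<mu> \<omega>) F - measure (\<nu> \<omega>) F)) \<in> borel_measurable M"
    by (rule tv_norm_measurable[OF C meas bdd])
  moreover have "tv_norm (sets (borel_on S)) (\<lambda>F. measure (\<mu> \<omega>) F - measure (\<nu> \<omega>) F)
      = tv_norm \<C> (\<lambda>F. measure (\<mu> \<omega>) F - measure (\<nu> \<omega>) F)" if \<omega>: "\<omega> \<in> space M" for \<omega>
  proof (rule tv_norm_eq_dense[OF CS C(2) bdd[OF \<omega> \<omega>]])
    fix F and e :: real assume F: "F \<in> sets (borel_on S)" and "e > 0"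
    then have "e / 2 > 0" by simp
    from finite_union_basis_approx_on[OF S subprob_space.axioms(1)[OF sub(1)[OF \<omega> \<mu>]]
        subprob_space.axioms(1)[OF sub(1)[OF \<omega> \<nu>]] sub(2)[OF \<omega> \<mu>] sub(2)[OF \<omega> \<nu>] B(2,1) F this]
    obtain D where "finite D" "D \<subseteq> B"
      and D: "\<bar>measure (\<mu> \<omega>) F - measure (\<mu> \<omega>) (\<Union>D \<inter> S)\<bar> < e / 2"
        "\<bar>measure (\<nu> \<omega>) F - measure (\<nu> \<omega>) (\<Union>D \<inter> S)\<bar> < e / 2" by blast
    then have "\<Union>D \<inter> S \<in> \<C>" by (auto simp: \<C>_def)
    moreover have "\<bar>measure (\<mu> \<omega>) F - measure (\<nu> \<omega>) F
        - (measure (\<mu> \<omega>) (\<Union>D \<inter> S) - measure (\<nu> \<omega>) (\<Union>D \<inter> S))\<bar> < e"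
      using D by linarith
    ultimately show "\<exists>G\<in>\<C>. \<bar>measure (\<mu> \<omega>) F - measure (\<nu> \<omega>) F
        - (measure (\<mu> \<omega>) G - measure (\<nu> \<omega>) G)\<bar> < e" by blast
  qed
  ultimately show ?thesis by (simp cong: measurable_cong)
qed

section \<open>The filter as a random measure\<close>

text \<open>
  The total mass of the update is \<open>c / c\<close>, where \<open>c\<close> is the normalizer: this is \<open>1\<close> if
  \<open>0 < c < \<infinity>\<close>, and \<open>0\<close> in the two degenerate cases.
\<close>

lemma subprob_space_bayes_update:
  assumes "space \<mu> \<noteq> {}" and [measurable]: "h \<in> borel_measurable \<mu>"
  shows "subprob_space (bayes_update h \<mu>)"
proof (rule subprob_spaceI)
  let ?c = "\<integral>\<^sup>+x. ennreal (h x) \<partial>\<mu>"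
  have "emeasure (bayes_update h \<mu>) (space (bayes_update h \<mu>)) = (\<integral>\<^sup>+x. ennreal (h x) / ?c \<partial>\<mu>)"
    unfolding bayes_update_def by (subst emeasure_density) (auto intro!: nn_integral_cong)
  also have "\<dots> = ?c / ?c" by (rule nn_integral_divide) simp
  also have "\<dots> \<le> 1"
    by (cases "?c = 0 \<or> ?c = \<top>") (auto simp: ennreal_divide_self less_top)
  finally show "emeasure (bayes_update h \<mu>) (space (bayes_update h \<mu>)) \<le> 1" .
qed (use assms in \<open>simp add: bayes_update_def\<close>)

lemma bayes_update_measurable:
  assumes h: "(\<lambda>(\<omega>, x). h \<omega> x) \<in> borel_measurable (M \<Otimes>\<^sub>M N)"
    and L: "L \<in> M \<rightarrow>\<^sub>M subprob_algebra N"
  shows "(\<lambda>\<omega>. bayes_update (h \<omega>) (L \<omega>)) \<in> M \<rightarrow>\<^sub>M subprob_algebra N"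
proof (rule measurable_subprob_algebra)
  note [measurable] = h
  have c[measurable]: "(\<lambda>\<omega>. \<integral>\<^sup>+x. ennreal (h \<omega> x) \<partial>L \<omega>) \<in> borel_measurable M"
    by (rule nn_integral_measurable_subprob_algebra2[OF _ L]) measurable
  have sp: "space (L \<omega>) \<noteq> {}" "sets (L \<omega>) = sets N" if "\<omega> \<in> space M" for \<omega>
    using measurable_space[OF L that] subprob_space.subprob_not_empty
    by (auto simp: space_subprob_algebra)
  have hm: "h \<omega> \<in> borel_measurable (L \<omega>)" if "\<omega> \<in> space M" for \<omega>
    using measurable_Pair2[OF h that] by (simp add: measurable_cong_sets[OF sp(2)[OF that] refl])
  show "subprob_space (bayes_update (h \<omega>) (L \<omega>))" if "\<omega> \<in> space M" for \<omega>
    by (rule subprob_space_bayes_update[OF sp(1)[OF that] hm[OF that]])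
  show "sets (bayes_update (h \<omega>) (L \<omega>)) = sets N" if "\<omega> \<in> space M" for \<omega>
    using sp[OF that] by (simp add: bayes_update_def)
  fix A assume A[measurable]: "A \<in> sets N"
  have "(\<lambda>\<omega>. \<integral>\<^sup>+x. ennreal (h \<omega> x) / (\<integral>\<^sup>+x'. ennreal (h \<omega> x') \<partial>L \<omega>) * indicator A x \<partial>L \<omega>)
      \<in> borel_measurable M"
    by (rule nn_integral_measurable_subprob_algebra2[OF _ L]) measurable
  moreover have "emeasure (bayes_update (h \<omega>) (L \<omega>)) A =
      (\<integral>\<^sup>+x. ennreal (h \<omega> x) / (\<integral>\<^sup>+x'. ennreal (h \<omega> x') \<partial>L \<omega>) * indicator A x \<partial>L \<omega>)"
    if "\<omega> \<in> space M" for \<omega>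
    unfolding bayes_update_def using hm[OF that] A sp[OF that] by (intro emeasure_density) auto
  ultimately show "(\<lambda>\<omega>. emeasure (bayes_update (h \<omega>) (L \<omega>)) A) \<in> borel_measurable M"
    by (simp cong: measurable_cong)
qed

context state_space_model
begin

lemma filter_upto_measurable:
  assumes Y: "\<And>t. t \<ge> 1 \<Longrightarrow> Y t \<in> M \<rightarrow>\<^sub>M borel_on Obs" and \<mu>: "\<mu> \<in> borel_probs S"
  shows "(\<lambda>\<omega>. filter_upto K g (\<lambda>s. Y s \<omega>) t \<mu>) \<in> M \<rightarrow>\<^sub>M subprob_algebra (borel_on S)"
proof (induction t)
  case 0
  show ?case using \<mu> by (simp add: space_prob_algebra space_subprob_algebra prob_space_imp_subprob_space)
next
  case (Suc t)
  have "(\<lambda>\<omega>. filter_upto K g (\<lambda>s. Y s \<omega>) t \<mu> \<bind> K (Suc t)) \<in> M \<rightarrow>\<^sub>M subprob_algebra (borel_on S)"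
    by (rule measurable_bind2[OF Suc measurable_prob_algebraD[OF kernel]]) simp
  moreover have "(\<lambda>(\<omega>, x). g (Suc t) (Y (Suc t) \<omega>) x) \<in> borel_measurable (M \<Otimes>\<^sub>M borel_on S)"
  proof -
    have [measurable]: "Y (Suc t) \<in> M \<rightarrow>\<^sub>M borel_on Obs" by (rule Y) simp
    have "(\<lambda>p. (Y (Suc t) (fst p), snd p)) \<in> M \<Otimes>\<^sub>M borel_on S \<rightarrow>\<^sub>M borel_on Obs \<Otimes>\<^sub>M borel_on S"
      by measurable
    from measurable_compose[OF this g_measurable[of "Suc t"]] show ?thesis
      by (simp add: case_prod_beta)
  qed
  ultimately show ?case by (simp add: filter_step_def bayes_update_measurable)
qed

lemma filter_error_measurable:
  assumes "\<And>t. t \<ge> 1 \<Longrightarrow> Y t \<in> M \<rightarrow>\<^sub>M borel_on Obs" and "\<mu> \<in> borel_probs S" "\<nu> \<in> borel_probs S"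
  shows "filter_error S K g Y \<mu> \<nu> t \<in> borel_measurable M"
  using tv_norm_subprob_measurable[OF borel_S filter_upto_measurable filter_upto_measurable] assms
  unfolding filter_error_def[abs_def] by blast

lemma filter_error_unit_interval:
  assumes "\<And>t. t \<ge> 1 \<Longrightarrow> Y t \<in> M \<rightarrow>\<^sub>M borel_on Obs" and "\<mu> \<in> borel_probs S" "\<nu> \<in> borel_probs S"
    and "\<omega> \<in> space M"
  shows "filter_error S K g Y \<mu> \<nu> t \<omega> \<in> {0..1}"
proof -
  have "subprob_space (filter_upto K g (\<lambda>s. Y s \<omega>) t \<rho>)" if "\<rho> \<in> borel_probs S" for \<rho>
    using measurable_space[OF filter_upto_measurable[of Y, OF assms(1) that] assms(4)]
    by (simp add: space_subprob_algebra)
  then show ?thesis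
    unfolding filter_error_def using assms
    by (intro tv_norm_unit_interval subprob_measure_diff_le_1) auto
qed

end

section \<open>Stability in expectation and in probability\<close>

theorem theorem3p10:
  fixes S :: "'x::euclidean_space set" and Obs :: "'y::euclidean_space set"
    and K :: "nat \<Rightarrow> 'x \<Rightarrow> 'x measure" and g :: "nat \<Rightarrow> 'y \<Rightarrow> 'x \<Rightarrow> real"
    and P :: "'x measure \<Rightarrow> 'w measure"
    and X :: "'x measure \<Rightarrow> nat \<Rightarrow> 'w \<Rightarrow> 'x" and Y :: "'x measure \<Rightarrow> nat \<Rightarrow> 'w \<Rightarrow> 'y"
  assumes "state_space_model S Obs K g"
    and "\<And>\<mu>. \<mu> \<in> borel_probs S \<Longrightarrow> model_process S Obs K g (P \<mu>) \<mu> (X \<mu>) (Y \<mu>)"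
  shows "(filter_stable S K g P Y \<longleftrightarrow>
           (\<forall>\<mu>\<in>borel_probs S. \<forall>\<nu>\<in>borel_probs S.
              converges_in_prob (P \<mu>) (filter_error S K g (Y \<mu>) \<mu> \<nu>) 0))
       \<and> (filter_stable S K g P Y \<or>
           (\<forall>\<mu>\<in>borel_probs S. \<forall>\<nu>\<in>borel_probs S.
              converges_in_prob (P \<mu>) (filter_error S K g (Y \<mu>) \<mu> \<nu>) 0)
          \<longrightarrow> (\<forall>\<mu>\<in>borel_probs S. \<forall>\<nu>\<in>borel_probs S.
                (\<lambda>t. prob_space.variance (P \<mu>) (filter_error S K g (Y \<mu>) \<mu> \<nu> t)) \<longlonglongrightarrow> 0))"
proof -
  have prob: "prob_space (P \<mu>)" and
    error: "filter_error S K g (Y \<mu>) \<mu> \<nu> t \<in> borel_measurable (P \<mu>)"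
      "\<And>\<omega>. \<omega> \<in> space (P \<mu>) \<Longrightarrow> filter_error S K g (Y \<mu>) \<mu> \<nu> t \<omega> \<in> {0..1}"
    if "\<mu> \<in> borel_probs S" "\<nu> \<in> borel_probs S" for \<mu> \<nu> t
  proof -
    interpret model_process S Obs K g "P \<mu>" \<mu> "X \<mu>" "Y \<mu>" by (rule assms(2)[OF that(1)])
    show "prob_space (P \<mu>)" by unfold_locales
    show "filter_error S K g (Y \<mu>) \<mu> \<nu> t \<in> borel_measurable (P \<mu>)"
      by (rule filter_error_measurable[OF Y_measurable that])
    show "filter_error S K g (Y \<mu>) \<mu> \<nu> t \<omega> \<in> {0..1}" if "\<omega> \<in> space (P \<mu>)" for \<omega>
      by (rule filter_error_unit_interval[OF Y_measurable \<open>\<mu> \<in> _\<close> \<open>\<nu> \<in> _\<close> that])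
  qed
  have iff: "filter_stable S K g P Y \<longleftrightarrow>
      (\<forall>\<mu>\<in>borel_probs S. \<forall>\<nu>\<in>borel_probs S.
        converges_in_prob (P \<mu>) (filter_error S K g (Y \<mu>) \<mu> \<nu>) 0)"
    unfolding filter_stable_def
    by (intro ball_cong refl prob_space.mean_tendsto_0_iff_converges_in_prob[OF prob error])
  moreover have "\<forall>\<mu>\<in>borel_probs S. \<forall>\<nu>\<in>borel_probs S.
      (\<lambda>t. prob_space.variance (P \<mu>) (filter_error S K g (Y \<mu>) \<mu> \<nu> t)) \<longlonglongrightarrow> 0"
    if "filter_stable S K g P Y"
    using that unfolding filter_stable_def
    by (intro ballI prob_space.variance_tendsto_0[OF prob error]) blast+
  ultimately show ?thesis by blast
qed

end
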